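(* Let $\alpha,\gamma>0$ be real numbers. Then every solution $\{(x_n,y_n)\}_{n\ge 0}$ of the rational system $$x_{n+1}=\frac{y_{n}}{x_{n}},\qquad y_{n+1}=\frac{\alpha+\gamma y_{n}}{x_{n}+y_{n}},\quad n=0,1,\dots,$$ with nonnegative real initial conditions $x_0,y_0\ge 0$ chosen to avoid division by zero, is bounded.
   Context: "Chosen to avoid division by zero" means that the initial conditions are such that no denominator occurring in the recursion vanishes for any $n\ge 0$, so that the solution is defined for all $n$. A solution $\{(x_n,y_n)\}_{n\ge 0}$ is bounded if both sequences $\{x_n\}_{n\ge 0}$ and $\{y_n\}_{n\ge 0}$ are bounded, i.e. there is a constant $M$ (which may depend on the solution) such that $|x_n|\le M$ and $|y_n|\le M$ for all $n\ge 0$. *)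

theory Defs
  imports Complex_Main
begin

definition rational_system_solution ::
  "real \<Rightarrow> real \<Rightarrow> (nat \<Rightarrow> real) \<Rightarrow> (nat \<Rightarrow> real) \<Rightarrow> bool"
where
  "rational_system_solution \<alpha> \<gamma> x y \<longleftrightarrow>
     (\<forall>n. x (Suc n) = y n / x n \<and> y (Suc n) = (\<alpha> + \<gamma> * y n) / (x n + y n))"

(* In HOL division by zero yields zero, so the recursion alone does not say that it is
   well defined. Since a solution is determined by its initial values, the following is a
   condition on x 0 and y 0. *)
definition avoids_division_by_zero :: "(nat \<Rightarrow> real) \<Rightarrow> (nat \<Rightarrow> real) \<Rightarrow> bool"
where
  "avoids_division_by_zero x y \<longleftrightarrow> (\<forall>n. x n \<noteq> 0 \<and> x n + y n \<noteq> 0)"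

end

theory Submission
  imports Defs
begin

text \<open>
  A solution stays positive, since \<open>y n = 0\<close> would force the denominator \<open>x (Suc n)\<close> to vanish.
  Because \<open>y n = x n * x (Suc n)\<close>, it suffices to bound \<open>x\<close>.

  Eliminating one step gives \<open>x (n + 2) = (\<gamma> + \<alpha> / y n) / (1 + x (n + 1))\<close>. Using this at \<open>n + 1\<close>
  and inserting the recursion for \<open>y (n + 1)\<close> yields, with \<open>a = x n\<close>, \<open>p = y n\<close>, \<open>c = x (n + 2)\<close>,
  \[ x_{n+3} = \frac{\gamma + \alpha (a + p) / (\alpha + \gamma p)}{1 + c}. \]
  The numerator is at most \<open>\<gamma> + \<alpha> / \<gamma> + a\<close>, so \<open>x\<close> grows by at most a constant in three steps.
  In fact \<open>x (n + 3)\<close> can be close to a large \<open>a\<close> only if \<open>p\<close> and \<open>c\<close> are both small, and they never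
  are: if \<open>p \<ge> \<alpha> / \<gamma>\<close>, the coefficient \<open>\<alpha> / (\<alpha> + \<gamma> p)\<close> of \<open>a\<close> is at most \<open>1 / 2\<close>, whereas if
  \<open>p \<le> \<alpha> / \<gamma>\<close> and \<open>a \<ge> 1\<close>, then \<open>x (n + 1) = p / a\<close> is bounded by \<open>\<alpha> / \<gamma>\<close> and \<open>c\<close> is bounded away
  from zero. Hence \<open>x (n + 3) \<le> C + \<theta> * x n\<close> with constants \<open>C\<close> and \<open>\<theta> < 1\<close>, which bounds \<open>x\<close>.
\<close>

lemma bounded_above_of_contraction_three_steps:
  fixes u :: "nat \<Rightarrow> real"
  assumes step: "\<And>n. u (n + 3) \<le> C + \<theta> * u n" and "0 \<le> \<theta>" "\<theta> < 1"
  shows "\<exists>B. \<forall>n. u n \<le> B"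
proof -
  \<comment> \<open>Any bound above the fixed point \<open>C / (1 - \<theta>)\<close> of the majorizing affine map is preserved.\<close>
  define B where "B = Max {u 0, u 1, u 2, C / (1 - \<theta>)}"
  have "C / (1 - \<theta>) \<le> B"
    by (simp add: B_def)
  then have fixed: "C + \<theta> * B \<le> B"
    using \<open>\<theta> < 1\<close> by (simp add: field_simps)
  have "u n \<le> B" for n
  proof (induction n rule: less_induct)
    case (less n)
    show ?case
    proof (cases "n < 3")
      case True
      then have "n = 0 \<or> n = 1 \<or> n = 2" by auto
      then show ?thesis by (auto simp: B_def)
    next
      case False
      then obtain m where m: "n = m + 3"
        by (metis add.commute le_Suc_ex not_less)
      then have "u m \<le> B" using less by simp
      then have "\<theta> * u m \<le> \<theta> * B"
        using \<open>0 \<le> \<theta>\<close> by (rule mult_left_mono)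
      then show ?thesis using step[of m] fixed m by simp
    qed
  qed
  then show ?thesis by blast
qed

lemma solution_positive:
  assumes "\<alpha> > 0" "\<gamma> > 0" "x 0 \<ge> 0" "y 0 \<ge> 0"
    and sol: "rational_system_solution \<alpha> \<gamma> x y"
    and avoid: "avoids_division_by_zero x y"
  shows "x n > 0 \<and> y n > 0"
proof -
  have x_Suc: "x (Suc n) = y n / x n" and y_Suc: "y (Suc n) = (\<alpha> + \<gamma> * y n) / (x n + y n)" for n
    using sol by (simp_all add: rational_system_solution_def)
  have x_ne: "x n \<noteq> 0" for n
    using avoid by (simp add: avoids_division_by_zero_def)
  have y_ne: "y n \<noteq> 0" for n
    using x_ne[of "Suc n"] x_Suc[of n] by auto
  show ?thesis
  proof (induction n)
    case 0
    then show ?case using assms(3,4) x_ne[of 0] y_ne[of 0] by linarith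
  next
    case (Suc n)
    then show ?case using assms(1,2) by (simp add: x_Suc y_Suc add_pos_pos)
  qed
qed

text \<open>
  The denominator of \<open>y (Suc n)\<close> is \<open>x n + y n = x n * (1 + x (Suc n))\<close>, and its factor \<open>x n\<close>
  cancels in \<open>x (Suc (Suc n)) = y (Suc n) * (x n / y n)\<close>.
\<close>

lemma x_two_steps:
  assumes sol: "rational_system_solution \<alpha> \<gamma> x y"
    and pos: "\<And>n. x n > 0 \<and> y n > 0"
  shows "x (Suc (Suc n)) = (\<gamma> + \<alpha> / y n) / (1 + x (Suc n))"
proof -
  have x_Suc: "x (Suc n) = y n / x n" and y_Suc: "y (Suc n) = (\<alpha> + \<gamma> * y n) / (x n + y n)" for n
    using sol by (simp_all add: rational_system_solution_def)
  have p: "x n > 0" "y n > 0" using pos by auto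
  then have "x n + y n > 0" by simp
  then have "1 + x (Suc n) = (x n + y n) / x n" "\<gamma> + \<alpha> / y n = (\<alpha> + \<gamma> * y n) / y n"
    using p by (simp_all add: x_Suc field_simps)
  then show ?thesis
    using p \<open>x n + y n > 0\<close> by (simp add: x_Suc[of "Suc n"] y_Suc x_Suc[of n])
qed

text \<open>
  The additional \<open>1\<close> in the constant absorbs the values \<open>x n < 1\<close>, for which \<open>x (n + 2)\<close> has no
  uniform lower bound.
\<close>

lemma x_three_steps_contraction:
  assumes "\<alpha> > 0" "\<gamma> > 0"
    and sol: "rational_system_solution \<alpha> \<gamma> x y"
    and pos: "\<And>n. x n > 0 \<and> y n > 0"
  shows "x (n + 3) \<le> (\<gamma> + \<alpha> / \<gamma> + 1) + max (1 / 2) (1 / (1 + \<gamma> / (1 + \<alpha> / \<gamma>))) * x n"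
    (is "_ \<le> ?K + 1 + max _ (1 / (1 + ?\<delta>)) * _")
proof -
  let ?\<theta> = "max (1 / 2) (1 / (1 + ?\<delta>))"
  define a p c where "a = x n" and "p = y n" and "c = x (n + 2)"
  have a: "a > 0" and p: "p > 0" and c: "c > 0"
    using pos by (auto simp: a_def p_def c_def)
  have b: "x (Suc n) = p / a" and y1: "y (Suc n) = (\<alpha> + \<gamma> * p) / (a + p)"
    using sol by (simp_all add: rational_system_solution_def a_def p_def)
  have c_eq: "c = (\<gamma> + \<alpha> / p) / (1 + p / a)"
    using x_two_steps[OF sol pos, of n] by (simp add: b c_def p_def)
  have d: "x (n + 3) = (\<gamma> + \<alpha> * (a + p) / (\<alpha> + \<gamma> * p)) / (1 + c)"
    using x_two_steps[OF sol pos, of "Suc n"] by (simp add: y1 c_def eval_nat_numeral)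
  have den: "\<alpha> + \<gamma> * p > 0" using assms(1,2) p by (simp add: add_pos_pos)
  have "\<alpha> * p / (\<alpha> + \<gamma> * p) \<le> \<alpha> / \<gamma>"
    using den assms(1,2) p by (simp add: field_simps)
  then have num: "\<gamma> + \<alpha> * (a + p) / (\<alpha> + \<gamma> * p) \<le> ?K + a * (\<alpha> / (\<alpha> + \<gamma> * p))"
    by (simp add: distrib_left add_divide_distrib mult.commute)
  have K: "?K > 0" using assms(1,2) by (simp add: add_pos_pos)
  have \<delta>: "?\<delta> > 0" using assms(1,2) by (simp add: add_pos_pos)
  have d_le: "x (n + 3) \<le> (?K + a * (\<alpha> / (\<alpha> + \<gamma> * p))) / (1 + c)"
    unfolding d using num c by (intro divide_right_mono) auto
  consider "p \<ge> \<alpha> / \<gamma>" | "p \<le> \<alpha> / \<gamma>" "a \<ge> 1" | "a \<le> 1" by linarith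
  then have "x (n + 3) \<le> ?K + 1 + ?\<theta> * a"
  proof cases
    case 1
    \<comment> \<open>Here the numerator provides the contraction.\<close>
    then have "\<alpha> / (\<alpha> + \<gamma> * p) \<le> 1 / 2"
      using den assms(1,2) by (simp add: field_simps)
    also have "\<dots> \<le> ?\<theta>" by simp
    finally have coeff: "a * (\<alpha> / (\<alpha> + \<gamma> * p)) \<le> ?\<theta> * a"
      using mult_left_mono[of _ ?\<theta> a] a by (simp only: mult.commute[of ?\<theta>] less_imp_le)
    have "(?K + a * (\<alpha> / (\<alpha> + \<gamma> * p))) / (1 + c) \<le> ?K + a * (\<alpha> / (\<alpha> + \<gamma> * p))"
      using c K a den assms(1) by (intro divide_left_mono[where b = 1, simplified]) auto
    then show ?thesis using d_le coeff by linarith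
  next
    case 2
    \<comment> \<open>Here the denominator \<open>1 + c\<close> provides the contraction.\<close>
    have "p / a \<le> p"
      using mult_left_mono[OF \<open>a \<ge> 1\<close>, of p] a p by (simp add: divide_le_eq)
    then have "1 + p / a \<le> 1 + \<alpha> / \<gamma>" using 2 by linarith
    moreover have "\<gamma> \<le> \<gamma> + \<alpha> / p" using assms(1) p by simp
    ultimately have \<delta>_le: "?\<delta> \<le> c"
      unfolding c_eq using a p assms(2) by (intro frac_le) (auto intro: add_pos_pos)
    have "a * (\<alpha> / (\<alpha> + \<gamma> * p)) \<le> a * 1"
      using a p den assms(1,2) by (intro mult_left_mono) (auto simp: divide_le_eq)
    then have "x (n + 3) \<le> (?K + a) / (1 + ?\<delta>)"
      using d_le \<delta>_le K a c \<delta> by (intro order_trans[OF d_le] frac_le) linarith+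
    also have "\<dots> = ?K / (1 + ?\<delta>) + 1 / (1 + ?\<delta>) * a"
      by (simp add: add_divide_distrib)
    also have "\<dots> \<le> ?K + ?\<theta> * a"
    proof (rule add_mono)
      have "?K / (1 + ?\<delta>) \<le> ?K / 1"
        using K \<delta> by (intro frac_le) linarith+
      then show "?K / (1 + ?\<delta>) \<le> ?K" by simp
      show "1 / (1 + ?\<delta>) * a \<le> ?\<theta> * a" using a by (intro mult_right_mono) auto
    qed
    finally show ?thesis by linarith
  next
    case 3
    have "a * (\<alpha> / (\<alpha> + \<gamma> * p)) \<le> 1 * 1"
      using 3 a p den assms(1,2) by (intro mult_mono) (auto simp: divide_le_eq)
    then have "x (n + 3) \<le> (?K + 1) / 1"
      using d_le K a c by (intro order_trans[OF d_le] frac_le) linarith+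
    moreover have "?\<theta> * a \<ge> 0" using a by (intro mult_nonneg_nonneg) auto
    ultimately show ?thesis by simp
  qed
  then show ?thesis by (simp add: a_def)
qed

theorem corollary1:
  fixes \<alpha> \<gamma> :: real and x y :: "nat \<Rightarrow> real"
  assumes "\<alpha> > 0" and "\<gamma> > 0"
    and "x 0 \<ge> 0" and "y 0 \<ge> 0"
    and "rational_system_solution \<alpha> \<gamma> x y"
    and "avoids_division_by_zero x y"
  shows "Bseq x \<and> Bseq y"
proof
  note pos = solution_positive[OF assms]
  define C \<theta> where "C = \<gamma> + \<alpha> / \<gamma> + 1" and "\<theta> = max (1 / 2) (1 / (1 + \<gamma> / (1 + \<alpha> / \<gamma>)))"
  have "\<gamma> / (1 + \<alpha> / \<gamma>) > 0" using assms(1,2) by (simp add: add_pos_pos)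
  then have "0 \<le> \<theta>" "\<theta> < 1" by (simp_all add: \<theta>_def le_max_iff_disj)
  moreover have "x (n + 3) \<le> C + \<theta> * x n" for n
    unfolding C_def \<theta>_def by (rule x_three_steps_contraction[OF assms(1,2,5) pos])
  ultimately obtain B where B: "\<And>n. x n \<le> B"
    using bounded_above_of_contraction_three_steps[of x C \<theta>] by blast
  show Bx: "Bseq x"
    using B pos by (intro BseqI'[where K = B]) (simp add: less_imp_le)
  have "y = (\<lambda>n. x n * x (Suc n))"
  proof
    fix n
    show "y n = x n * x (Suc n)"
      using assms(5) pos[of n] by (simp add: rational_system_solution_def)
  qed
  moreover have "Bseq (\<lambda>n. x n * x (Suc n))"
    using Bx by (intro Bseq_mult) (simp_all add: Bseq_Suc_iff)
  ultimately show "Bseq y" by simp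
qed

end
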